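(* Let $n\ge 1$ and consider the $n$-vertex Fibonacci graph $FG$ (vertices $1,\dots,n$; edges $(v,v+1)$ labelled $a_v$ for $1\le v\le n-1$ and $(v,v+2)$ labelled $b_v$ for $1\le v\le n-2$). Let $T(n)$ and $P(n)$ be the total number of terms and the number of plus operators in the expression of $FG$ produced by the DLS method. Then: 1. $T(1)=0$, $T(2)=1$, $T(3)=3$, and $T(n)=T(n-2)+T(n-3)+5$ for $n>3$. 2. $P(1)=0$, $P(2)=0$, $P(3)=1$, and $P(n)=P(n-2)+P(n-3)+2$ for $n>3$.
   Context: The DLS method defines subexpressions $E_i$ for $i=n,n-1,\dots,1$: $E_n=1$; $E_{n-1}=a_{n-1}$; $E_{n-2}=a_{n-2}a_{n-1}+b_{n-2}$; and for $i<n-2$, $E_i=(a_ia_{i+1}+b_i)E_{i+2}+a_ib_{i+1}E_{i+3}$ (sums are parenthesized when multiplied). The resulting expression is $E_1$. A factor equal to the constant $1$ is omitted from products, and the constant $1$ is not counted as a term. The total number of terms of an expression is the number of occurrences of edge labels in it, counted with multiplicity; the number of plus operators is the number of occurrences of $+$. *)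

theory Defs
  imports "Graph_Theory.Digraph" "HOL-Library.Multiset"
begin

datatype edge_label = A nat | B nat

text \<open>The arcs of the Fibonacci graph are identified with their labels.\<close>

definition fib_graph :: "nat \<Rightarrow> (nat, edge_label) pre_digraph" where
  "fib_graph n = \<lparr>
     verts = {1..n},
     arcs = {A v | v. 1 \<le> v \<and> v + 1 \<le> n} \<union> {B v | v. 1 \<le> v \<and> v + 2 \<le> n},
     tail = (\<lambda>e. case e of A v \<Rightarrow> v | B v \<Rightarrow> v),
     head = (\<lambda>e. case e of A v \<Rightarrow> v + 1 | B v \<Rightarrow> v + 2)\<rparr>"

text \<open>Parentheses are represented by the tree structure.\<close>

datatype 'l expr =
    One
  | Label 'l
  | Plus "'l expr" "'l expr"
  | Times "'l expr" "'l expr"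

text \<open>The product of expressions, in which a factor \<open>One\<close> is omitted.\<close>

definition times_expr :: "'l expr \<Rightarrow> 'l expr \<Rightarrow> 'l expr" where
  "times_expr e f = (if e = One then f else if f = One then e else Times e f)"

text \<open>The subexpression \<open>E\<^sub>i\<close> for the \<open>n\<close>-vertex graph is \<open>dls_sub n i\<close>. It is meaningful only
  for \<open>1 \<le> i \<le> n\<close>; the value for \<open>i > n\<close> is a dummy.\<close>

function dls_sub :: "nat \<Rightarrow> nat \<Rightarrow> edge_label expr" where
  "dls_sub n i =
     (if n \<le> i then One
      else if i + 1 = n then Label (A i)
      else if i + 2 = n then
        Plus (times_expr (Label (A i)) (Label (A (i + 1)))) (Label (B i))
      else
        Plus
          (times_expr
             (Plus (times_expr (Label (A i)) (Label (A (i + 1)))) (Label (B i)))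
             (dls_sub n (i + 2)))
          (times_expr
             (times_expr (Label (A i)) (Label (B (i + 1))))
             (dls_sub n (i + 3))))"
  by pat_completeness auto
termination
  by (relation "measure (\<lambda>(n, i). n - i)") auto

declare dls_sub.simps [simp del]

definition dls_expr :: "nat \<Rightarrow> edge_label expr" where
  "dls_expr n = dls_sub n 1"

primrec labels :: "'l expr \<Rightarrow> 'l multiset" where
  "labels One = {#}"
| "labels (Label l) = {#l#}"
| "labels (Plus e f) = labels e + labels f"
| "labels (Times e f) = labels e + labels f"

primrec num_plus :: "'l expr \<Rightarrow> nat" where
  "num_plus One = 0"
| "num_plus (Label l) = 0"
| "num_plus (Plus e f) = num_plus e + num_plus f + 1"
| "num_plus (Times e f) = num_plus e + num_plus f"

text \<open>The number of occurrences in \<open>e\<close> of labels of edges of the graph \<open>G\<close>.\<close>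

definition num_terms :: "('v, 'l) pre_digraph \<Rightarrow> 'l expr \<Rightarrow> nat" where
  "num_terms G e = size {#l \<in># labels e. l \<in> arcs G#}"

definition dls_terms :: "nat \<Rightarrow> nat" where
  "dls_terms n = num_terms (fib_graph n) (dls_expr n)"

definition dls_plus :: "nat \<Rightarrow> nat" where
  "dls_plus n = num_plus (dls_expr n)"

end

theory Submission
  imports Defs
begin

text \<open>The recursion for \<open>E\<^sub>i\<close> depends on \<open>n\<close> and \<open>i\<close> only through \<open>n - i\<close>, up to a renaming of labels.
  Hence \<open>E\<^sub>3\<close> and \<open>E\<^sub>4\<close> for \<open>n\<close> vertices have the same counts as \<open>E\<^sub>1\<close> for \<open>n - 2\<close> and \<open>n - 3\<close> vertices,
  and \<open>E\<^sub>1 = (a\<^sub>1a\<^sub>2 + b\<^sub>1)E\<^sub>3 + a\<^sub>1b\<^sub>2E\<^sub>4\<close> contributes five further labels and two further plus operators.\<close>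

text \<open>Omitting a factor \<open>One\<close> loses nothing, since \<open>One\<close> carries no
  labels.\<close>

lemma labels_times_expr [simp]: "labels (times_expr e f) = labels e + labels f"
  by (simp add: times_expr_def)

lemma num_plus_times_expr [simp]: "num_plus (times_expr e f) = num_plus e + num_plus f"
  by (simp add: times_expr_def)

lemma dls_sub_refl [simp]: "dls_sub n n = One"
  by (simp add: dls_sub.simps)

text \<open>Makes the filter in \<open>num_terms\<close> vacuous. The bound on \<open>i\<close>
  keeps out \<open>A 0\<close> and \<open>B 0\<close>, which are not arcs.\<close>

lemma labels_dls_sub_subset_arcs:
  "1 \<le> i \<Longrightarrow> set_mset (labels (dls_sub n i)) \<subseteq> arcs (fib_graph n)"
proof (induction n i rule: dls_sub.induct)
  case (1 n i)
  then show ?case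
    by (subst dls_sub.simps) (auto simp: fib_graph_def)
qed

lemma size_labels_dls_sub_shift:
  "size (labels (dls_sub (n + k) (i + k))) = size (labels (dls_sub n i))"
proof (induction n i rule: dls_sub.induct)
  case (1 n i)
  then show ?case
    by (subst (1 2) dls_sub.simps) (auto simp: ac_simps)
qed

lemma num_plus_dls_sub_shift:
  "num_plus (dls_sub (n + k) (i + k)) = num_plus (dls_sub n i)"
proof (induction n i rule: dls_sub.induct)
  case (1 n i)
  then show ?case
    by (subst (1 2) dls_sub.simps) (auto simp: ac_simps)
qed

lemma dls_terms_eq_size: "dls_terms n = size (labels (dls_expr n))"
proof -
  have "filter_mset (\<lambda>l. l \<in> arcs (fib_graph n)) (labels (dls_expr n)) = labels (dls_expr n)"
    using labels_dls_sub_subset_arcs[of 1 n]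
    by (auto simp: filter_mset_eq_conv dls_expr_def)
  then show ?thesis
    by (simp add: dls_terms_def num_terms_def)
qed

theorem theorem3:
  shows "(dls_terms 1 = 0 \<and> dls_terms 2 = 1 \<and> dls_terms 3 = 3 \<and>
       (\<forall>n>3. dls_terms n = dls_terms (n - 2) + dls_terms (n - 3) + 5)) \<and>
     (dls_plus 1 = 0 \<and> dls_plus 2 = 0 \<and> dls_plus 3 = 1 \<and>
       (\<forall>n>3. dls_plus n = dls_plus (n - 2) + dls_plus (n - 3) + 2))"
proof -
  have small: "dls_expr 1 = One" "dls_expr 2 = Label (A 1)"
    "dls_expr 3 = Plus (times_expr (Label (A 1)) (Label (A 2))) (Label (B 1))"
    by (simp_all add: dls_expr_def dls_sub.simps numeral_2_eq_2)
  have step: "dls_expr n =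
      Plus
        (times_expr (Plus (times_expr (Label (A 1)) (Label (A 2))) (Label (B 1))) (dls_sub n 3))
        (times_expr (times_expr (Label (A 1)) (Label (B 2))) (dls_sub n 4))" if "n > 3" for n
    unfolding dls_expr_def using that by (subst dls_sub.simps) (simp add: eval_nat_numeral)
  have terms: "dls_terms n = dls_terms (n - 2) + dls_terms (n - 3) + 5" if "n > 3" for n
    \<comment> \<open>Shifts by 2 and 3 match \<open>dls_sub n 3\<close> and
      \<open>dls_sub n 4\<close> with \<open>dls_expr (n - 2)\<close> and
      \<open>dls_expr (n - 3)\<close>; as \<open>n > 3\<close>, no subtraction truncates.\<close>
    using size_labels_dls_sub_shift[of "n - 2" 2 1] size_labels_dls_sub_shift[of "n - 3" 3 1] that
    by (simp add: dls_terms_eq_size step del: add_2_eq_Suc') (simp add: dls_expr_def)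
  have plus: "dls_plus n = dls_plus (n - 2) + dls_plus (n - 3) + 2" if "n > 3" for n
    using num_plus_dls_sub_shift[of "n - 2" 2 1] num_plus_dls_sub_shift[of "n - 3" 3 1] that
    by (simp add: dls_plus_def step del: add_2_eq_Suc') (simp add: dls_expr_def)
  show ?thesis
    using small terms plus by (simp add: dls_terms_eq_size dls_plus_def)
qed

end
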